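(* Fix an integer $d\ge 1$. For every $\gamma>0$ there is a constant $C$ depending only on $\gamma$ and $d$ such that the following holds for every $n\ge 2$ and every set $S=\{s_1,\dots,s_n\}$ of $n$ distinct sites in the plane. If each site $s_i$ is assigned a random parametric point $\beta_i\in[0,1]^d$ according to the sampling model, then with probability at least $1-n^{-\gamma}$, simultaneously for all points $x\in\mathbb{R}^2$, the candidate set of $x$ satisfies $|\mathsf{C}(x)|\le C\log^{d} n$.
   Context: Sampling model: the site locations are fixed. The parametric points $\beta_1,\dots,\beta_n$ are independent. For each site, the $j$-th coordinate of its parametric point is drawn from a continuous (atomless) distribution $\mathcal{D}_j$ on $[0,1]$, independently over $j=1,\dots,d$. All sampled values are assumed distinct. For $p,q\in\mathbb{R}^m$, $p$ dominates $q$ if $p_i\le q_i$ for all $i$. A point $p$ of $P\subseteq\mathbb{R}^m$ is a staircase point of $P$ if no other point of $P$ dominates it. For $x\in\mathbb{R}^2$ let $\ell_i=\|x-s_i\|$ and $P(x)=\{(\beta_1,\ell_1),\dots,(\beta_n,\ell_n)\}\subset\mathbb{R}^{d+1}$. The candidate set of $x$ is $\mathsf{C}(x)=\{s_i:(\beta_i,\ell_i)\text{ is a staircase point of }P(x)\}$. *)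

theory Defs
  imports "HOL-Probability.Probability"
begin

text \<open>
  A point of \<open>m\<close>-dimensional real space is represented by its coordinate function on
  \<open>{..<m}\<close>, extended by \<open>undefined\<close>, i.e. by an element of
  \<open>{..<m} \<rightarrow>\<^sub>E UNIV\<close>, so that HOL equality is equality of points. Sites and coordinates are
  numbered from 0.
\<close>

definition dominates :: "nat \<Rightarrow> (nat \<Rightarrow> real) \<Rightarrow> (nat \<Rightarrow> real) \<Rightarrow> bool" where
  "dominates m p q \<longleftrightarrow> (\<forall>i<m. p i \<le> q i)"

definition staircase_point :: "nat \<Rightarrow> (nat \<Rightarrow> real) set \<Rightarrow> (nat \<Rightarrow> real) \<Rightarrow> bool" where
  "staircase_point m P p \<longleftrightarrow> p \<in> P \<and> \<not> (\<exists>q\<in>P. q \<noteq> p \<and> dominates m q p)"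

text \<open>
  The point \<open>(\<beta>\<^sub>i, \<ell>\<^sub>i)\<close>: as \<open>\<beta> i\<close> is supported on \<open>{..<d}\<close>, the update at \<open>d\<close> appends
  the distance from \<open>x\<close> to \<open>s i\<close> as last coordinate.
\<close>

definition lifted_point ::
    "nat \<Rightarrow> (nat \<Rightarrow> real^2) \<Rightarrow> (nat \<Rightarrow> nat \<Rightarrow> real) \<Rightarrow> real^2 \<Rightarrow> nat \<Rightarrow> (nat \<Rightarrow> real)" where
  "lifted_point d s \<beta> x i = (\<beta> i)(d := norm (x - s i))"

definition lifted_points ::
    "nat \<Rightarrow> nat \<Rightarrow> (nat \<Rightarrow> real^2) \<Rightarrow> (nat \<Rightarrow> nat \<Rightarrow> real) \<Rightarrow> real^2 \<Rightarrow> (nat \<Rightarrow> real) set" where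
  "lifted_points d n s \<beta> x = lifted_point d s \<beta> x ` {..<n}"

definition candidate_set ::
    "nat \<Rightarrow> nat \<Rightarrow> (nat \<Rightarrow> real^2) \<Rightarrow> (nat \<Rightarrow> nat \<Rightarrow> real) \<Rightarrow> real^2 \<Rightarrow> (real^2) set" where
  "candidate_set d n s \<beta> x =
     {s i | i. i < n \<and> staircase_point (d + 1) (lifted_points d n s \<beta> x) (lifted_point d s \<beta> x i)}"

definition atomless_unit_distribution :: "real measure \<Rightarrow> bool" where
  "atomless_unit_distribution D \<longleftrightarrow>
     real_distribution D \<and> measure D {0..1} = 1 \<and> (\<forall>x. measure D {x} = 0)"

text \<open>
  The joint law of \<open>(\<beta>\<^sub>0, \<dots>, \<beta>\<^sub>n\<^sub>-\<^sub>1)\<close>: the inner product expresses independence of the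
  coordinates of one parametric point (the \<open>j\<close>-th one having law \<open>D j\<close>), the outer one
  independence of the parametric points.
\<close>

definition sampling_model ::
    "nat \<Rightarrow> nat \<Rightarrow> (nat \<Rightarrow> real measure) \<Rightarrow> (nat \<Rightarrow> nat \<Rightarrow> real) measure" where
  "sampling_model d n D = (\<Pi>\<^sub>M i\<in>{..<n}. \<Pi>\<^sub>M j\<in>{..<d}. D j)"

definition distinct_values :: "nat \<Rightarrow> nat \<Rightarrow> (nat \<Rightarrow> nat \<Rightarrow> real) \<Rightarrow> bool" where
  "distinct_values d n \<beta> \<longleftrightarrow> inj_on (\<lambda>(i, j). \<beta> i j) ({..<n} \<times> {..<d})"

end

theory Submission
  imports Defs
begin

text \<open>
  The candidates of \<open>x\<close> depend on \<open>x\<close> only through the order of the sites by distance to \<open>x\<close>. The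
  bisectors of the sites form an arrangement of at most \<open>n\<^sup>2\<close> lines, so there are at most \<open>n ^ 6\<close> such
  orders, and by a union bound it suffices to bound, for one fixed order, the probability of more than
  \<open>C ln\<^sup>d n\<close> candidates by \<open>n\<close> to the power \<open>-(\<gamma> + 6)\<close>.

  Insert the sites in this order. A site is a candidate if it is a minimum of the parametric points
  inserted so far. The number of minima of a fixed set in dimension \<open>d + 1\<close> is, once the last
  coordinate is fixed, a number of candidates in dimension \<open>d\<close> for the order given by that coordinate;
  by induction on \<open>d\<close> it exceeds \<open>L = C' ln\<^sup>d n\<close> with small probability. By exchangeability the
  \<open>a\<close>-th inserted site is a minimum with conditional probability at most \<open>L / a\<close> as long as there are
  at most \<open>L\<close> minima, even given all later events. Hence the number of candidates has exponential
  moment at most \<open>exp (2 L H\<^sub>n)\<close>, and Markov's inequality gives the bound \<open>O(ln\<^sup>d\<^sup>+\<^sup>1 n)\<close>.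
\<close>

section \<open>Distance orders\<close>

text \<open>Induction over the hyperplanes: a new one adds only as many patterns as it splits, and
  split patterns are counted on its intersection with \<open>V\<close>, one dimension lower. Hence
  \<open>V\<close> is an arbitrary affine set. The crude bound \<open>(m + 1) ^ k\<close> suits the
  recursion: for k > 0, (m + 1)^k + (m + 1)^(k - 1) = (m + 2)(m + 1)^(k - 1) \<le> (m +
  2)^k.\<close>

lemma card_sign_patterns_le:
  fixes a :: "'i \<Rightarrow> 'a::euclidean_space" and b :: "'i \<Rightarrow> real"
  assumes "finite J" "affine V" "aff_dim V \<le> int k"
  shows "finite ((\<lambda>x. {i\<in>J. a i \<bullet> x \<le> b i}) ` V) \<and>
    card ((\<lambda>x. {i\<in>J. a i \<bullet> x \<le> b i}) ` V) \<le> (card J + 1) ^ k"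
  using assms
proof (induction J arbitrary: V k rule: finite_induct)
  case empty
  have "(\<lambda>x. {i\<in>{}. a i \<bullet> x \<le> b i}) ` V \<subseteq> {{}}"
    by auto
  from finite_subset[OF this] card_mono[OF _ this] show ?case
    by simp
next
  case (insert j J)
  define P where "P = (\<lambda>x. {i\<in>J. a i \<bullet> x \<le> b i})"
  define Q where "Q = (\<lambda>x. {i\<in>insert j J. a i \<bullet> x \<le> b i})"
  define H where "H = V \<inter> {x. a j \<bullet> x = b j}"
  have aff_H: "affine H"
    unfolding H_def using insert.prems affine_hyperplane by (intro affine_Int)
  have PV: "finite (P ` V)" "card (P ` V) \<le> (card J + 1) ^ k"
    using insert.IH[OF insert.prems] by (auto simp: P_def)
  \<comment> \<open>A pattern that extends in both ways is attained on both sides of the new hyperplane, hence, by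
    convexity, also on the hyperplane itself, where the dimension is smaller.\<close>
  define B where "B = {S \<in> P ` V. S \<in> Q ` V \<and> insert j S \<in> Q ` V}"
  have on_H: "B \<subseteq> P ` H"
  proof
    fix S assume "S \<in> B"
    then obtain x y where x: "x \<in> V" "S = Q x" and y: "y \<in> V" "insert j S = Q y" and S: "S \<subseteq> J"
      by (auto simp: B_def P_def)
    have "j \<notin> S"
      using S insert.hyps by auto
    then have xj: "a j \<bullet> x > b j"
      using x by (auto simp: Q_def not_le)
    have yj: "a j \<bullet> y \<le> b j"
      using y by (auto simp: Q_def)
    have S_eq: "S = P x" "S = P y"
    proof -
      have "P v = Q v - {j}" for v
        using insert.hyps by (auto simp: P_def Q_def)
      then show "S = P x" "S = P y"
        using \<open>j \<notin> S\<close> by (simp_all flip: x(2) y(2))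
    qed
    \<comment> \<open>The parameter at which the segment from \<open>x\<close> to \<open>y\<close>
      meets the new hyperplane; \<open>x\<close> lies strictly outside the half-space and
      \<open>y\<close> inside, so the denominator is positive.\<close>
    define t where "t = (a j \<bullet> x - b j) / (a j \<bullet> x - a j \<bullet> y)"
    have t: "0 \<le> t" "t \<le> 1"
      using xj yj by (auto simp: t_def field_simps)
    define z where "z = (1 - t) *\<^sub>R x + t *\<^sub>R y"
    have inner_z: "a i \<bullet> z = (1 - t) * (a i \<bullet> x) + t * (a i \<bullet> y)" for i
      by (simp add: z_def inner_add_right)
    have "t * (a j \<bullet> x - a j \<bullet> y) = a j \<bullet> x - b j"
      using xj yj by (simp add: t_def)
    then have "a j \<bullet> z = b j"
      by (simp add: inner_z algebra_simps)
    moreover have "z \<in> V"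
      using x(1) y(1) insert.prems(1) by (simp add: z_def affine_alt algebra_simps)
    ultimately have "z \<in> H"
      by (simp add: H_def)
    moreover have "P z = S"
    proof -
      have "a i \<bullet> z \<le> b i \<longleftrightarrow> i \<in> S" if i: "i \<in> J" for i
      proof (cases "i \<in> S")
        case True
        then have "a i \<bullet> x \<le> b i" "a i \<bullet> y \<le> b i"
          using S_eq by (auto simp: P_def)
        then show ?thesis
          using True t convex_bound_le[of "a i \<bullet> x" "b i" "a i \<bullet> y" "1 - t" t] by (simp add: inner_z)
      next
        case False
        then have "a i \<bullet> x > b i" "a i \<bullet> y > b i"
          using S_eq i by (force simp: P_def)+
        then have "- (a i \<bullet> z) < - b i"
          using t convex_bound_lt[of "- (a i \<bullet> x)" "- b i" "- (a i \<bullet> y)" "1 - t" t] by (simp add: inner_z)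
        then show ?thesis
          using False by simp
      qed
      then show ?thesis
        using S unfolding P_def by blast
    qed
    ultimately show "S \<in> P ` H"
      by blast
  qed
  \<comment> \<open>If some pattern is split, \<open>V\<close> has points off the hyperplane and
    \<open>H\<close> is nonempty, so dim H = dim V - 1 \<ge> 0, which forces k > 0. For k = 0 no
    pattern is split.\<close>
  have B_bound: "card B \<le> (if k = 0 then 0 else (card J + 1) ^ (k - 1))"
  proof (cases "B = {}")
    case False
    then obtain S where "S \<in> B" by blast
    then obtain x y where x: "x \<in> V" "S = Q x" and y: "y \<in> V" "insert j S = Q y" and S: "S \<subseteq> J"
      by (auto simp: B_def P_def)
    have "j \<notin> S"
      using S insert.hyps by auto
    then have "a j \<bullet> x > b j"
      using x by (auto simp: Q_def not_le)
    then have "\<not> V \<subseteq> {v. a j \<bullet> v = b j}"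
      using x by auto
    moreover have "H \<noteq> {}"
      using on_H False by auto
    ultimately have dim: "aff_dim H = aff_dim V - 1"
      using aff_dim_affine_Int_hyperplane[OF insert.prems(1), of "a j" "b j"] by (auto simp: H_def)
    have "aff_dim H \<ge> 0"
      using \<open>H \<noteq> {}\<close> aff_dim_negative_iff[of H] by linarith
    then have k: "k \<noteq> 0" "aff_dim H \<le> int (k - 1)"
      using dim insert.prems by auto
    then have "finite (P ` H)" "card (P ` H) \<le> (card J + 1) ^ (k - 1)"
      using insert.IH[OF aff_H k(2)] by (auto simp: P_def)
    then show ?thesis
      using card_mono[OF _ on_H] k by simp
  qed simp
  have "Q x = P x \<or> Q x = insert j (P x)" for x
    unfolding P_def Q_def by blast
  then have Q_sub: "Q ` V \<subseteq> P ` V \<union> insert j ` P ` V"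
    by blast
  then have fin: "finite (Q ` V)"
    by (rule finite_subset) (use PV in auto)
  \<comment> \<open>\<open>g\<close> picks one realized extension of each old pattern; a second
    extension exists only for the patterns in \<open>B\<close>.\<close>
  define g where "g S = (if S \<in> Q ` V then S else insert j S)" for S
  have "Q ` V \<subseteq> g ` P ` V \<union> insert j ` B"
  proof
    fix T assume T: "T \<in> Q ` V"
    then obtain S where S: "S \<in> P ` V" "T = S \<or> T = insert j S"
      using Q_sub by blast
    then have "T = g S \<or> T = insert j S \<and> S \<in> B"
      using T unfolding B_def g_def mem_Collect_eq by (cases "S \<in> Q ` V") (simp_all only: if_True if_False, blast+)
    then show "T \<in> g ` P ` V \<union> insert j ` B"
      using S(1) by blast
  qed
  then have "card (Q ` V) \<le> card (g ` P ` V \<union> insert j ` B)"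
    by (rule card_mono[rotated]) (use PV in \<open>auto simp: B_def\<close>)
  also have "\<dots> \<le> card (P ` V) + card B"
    using PV by (intro order.trans[OF card_Un_le] add_mono card_image_le) (auto simp: B_def)
  also have "\<dots> \<le> (card J + 1) ^ k + (if k = 0 then 0 else (card J + 1) ^ (k - 1))"
    using PV B_bound by simp
  also have "\<dots> \<le> (card (insert j J) + 1) ^ k"
  proof (cases k)
    case (Suc l)
    have "(card J + 1) ^ k + (card J + 1) ^ l = (card J + 2) * (card J + 1) ^ l"
      using Suc by simp
    also have "\<dots> \<le> (card J + 2) * (card J + 2) ^ l"
      by (intro mult_mono power_mono) auto
    finally show ?thesis
      using Suc insert.hyps by simp
  qed simp
  finally show ?case
    using fin by (simp add: Q_def)
qed

text \<open>After squaring, the term x \<bullet> x cancels, which leaves a linear condition bounded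
  by the bisector.\<close>

lemma norm_diff_le_iff_halfspace:
  fixes x u v :: "'a::real_inner"
  shows "norm (x - u) \<le> norm (x - v) \<longleftrightarrow> (2 *\<^sub>R (v - u)) \<bullet> x \<le> v \<bullet> v - u \<bullet> u"
  by (auto simp: norm_le inner_diff_left inner_diff_right inner_commute algebra_simps)

text \<open>Recorded as a non-strict relation, the order at \<open>x\<close> (ties included) is the
  sign pattern of \<open>x\<close> for n^2 half-spaces, one per ordered pair of indices, in
  dimension 2.\<close>

lemma card_distance_orders_le:
  fixes s :: "nat \<Rightarrow> real^2"
  shows "finite (range (\<lambda>x. {(i, k). i < n \<and> k < n \<and> norm (x - s i) \<le> norm (x - s k)}))"
    and "card (range (\<lambda>x. {(i, k). i < n \<and> k < n \<and> norm (x - s i) \<le> norm (x - s k)})) \<le> (n\<^sup>2 + 1)\<^sup>2"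
proof -
  define a where "a = (\<lambda>(i, k). 2 *\<^sub>R (s k - s i))"
  define b where "b = (\<lambda>(i, k). s k \<bullet> s k - s i \<bullet> s i)"
  have *: "{(i, k). i < n \<and> k < n \<and> norm (x - s i) \<le> norm (x - s k)} =
      {p \<in> {..<n} \<times> {..<n}. a p \<bullet> x \<le> b p}" for x
    by (auto simp: a_def b_def norm_diff_le_iff_halfspace)
  show "finite (range (\<lambda>x. {(i, k). i < n \<and> k < n \<and> norm (x - s i) \<le> norm (x - s k)}))"
    "card (range (\<lambda>x. {(i, k). i < n \<and> k < n \<and> norm (x - s i) \<le> norm (x - s k)})) \<le> (n\<^sup>2 + 1)\<^sup>2"
    using card_sign_patterns_le[of "{..<n} \<times> {..<n}" "UNIV :: (real^2) set" 2 a b]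
    unfolding * by (simp_all add: power2_eq_square)
qed

section \<open>Minima and exchangeability\<close>

text \<open>Samples are functions on pairs (site, coordinate), so that the joint law is a single
  product measure and a permutation of the sites is a reindexing of it.\<close>

definition coord_le :: "nat \<Rightarrow> (nat \<times> nat \<Rightarrow> real) \<Rightarrow> nat \<Rightarrow> nat \<Rightarrow> bool" where
  "coord_le d \<beta> k i \<longleftrightarrow> (\<forall>j<d. \<beta> (k, j) \<le> \<beta> (i, j))"

definition minima :: "nat \<Rightarrow> nat set \<Rightarrow> (nat \<times> nat \<Rightarrow> real) \<Rightarrow> nat set" where
  "minima d A \<beta> = {i \<in> A. \<not> (\<exists>k\<in>A. k \<noteq> i \<and> coord_le d \<beta> k i)}"

text \<open>The minima after \<open>h i\<close> is appended to each point as a deterministic last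
  coordinate. In use \<open>h\<close> is the distance to a query point or a frozen random
  coordinate.\<close>

definition undominated ::
    "nat \<Rightarrow> nat set \<Rightarrow> (nat \<Rightarrow> real) \<Rightarrow> (nat \<times> nat \<Rightarrow> real) \<Rightarrow> nat set" where
  "undominated d A h \<beta> = {i \<in> A. \<not> (\<exists>k\<in>A. k \<noteq> i \<and> h k \<le> h i \<and> coord_le d \<beta> k i)}"

lemma minima_subset: "minima d A \<beta> \<subseteq> A"
  and undominated_subset: "undominated d A h \<beta> \<subseteq> A"
  by (auto simp: minima_def undominated_def)

lemma minima_Suc_eq_undominated: "minima (Suc d) A \<beta> = undominated d A (\<lambda>i. \<beta> (i, d)) \<beta>"
  by (auto simp: minima_def undominated_def coord_le_def less_Suc_eq)

text \<open>Site \<open>i\<close> receives the point of site \<open>\<tau> i\<close>. The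
  restriction keeps the result in the space of the product measure.\<close>

definition permute_sites ::
    "nat set \<Rightarrow> nat \<Rightarrow> (nat \<Rightarrow> nat) \<Rightarrow> (nat \<times> nat \<Rightarrow> real) \<Rightarrow> nat \<times> nat \<Rightarrow> real" where
  "permute_sites I d \<tau> \<beta> = (\<lambda>p\<in>I \<times> {..<d}. \<beta> (\<tau> (fst p), snd p))"

lemma mem_minima_permute_sites:
  assumes \<tau>: "\<tau> permutes A" and "A \<subseteq> I" "i \<in> A"
  shows "i \<in> minima d A (permute_sites I d \<tau> \<beta>) \<longleftrightarrow> \<tau> i \<in> minima d A \<beta>"
proof -
  have le: "coord_le d (permute_sites I d \<tau> \<beta>) k l \<longleftrightarrow> coord_le d \<beta> (\<tau> k) (\<tau> l)"
    if "k \<in> A" "l \<in> A" for k l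
    using that \<open>A \<subseteq> I\<close> by (auto simp: coord_le_def permute_sites_def)
  have "(\<exists>k\<in>A. k \<noteq> i \<and> coord_le d \<beta> (\<tau> k) (\<tau> i)) \<longleftrightarrow> (\<exists>k\<in>\<tau> ` A. k \<noteq> \<tau> i \<and> coord_le d \<beta> k (\<tau> i))"
    using permutes_inj[OF \<tau>] by (auto simp: inj_eq)
  moreover have "(\<exists>k\<in>A. k \<noteq> i \<and> coord_le d (permute_sites I d \<tau> \<beta>) k i) \<longleftrightarrow>
      (\<exists>k\<in>A. k \<noteq> i \<and> coord_le d \<beta> (\<tau> k) (\<tau> i))"
    using le \<open>i \<in> A\<close> by blast
  ultimately show ?thesis
    using \<open>i \<in> A\<close> permutes_image[OF \<tau>] permutes_in_image[OF \<tau>, of i]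
    by (simp add: minima_def) blast
qed

lemma card_minima_permute_sites:
  assumes \<tau>: "\<tau> permutes A" and "A \<subseteq> I"
  shows "card (minima d A (permute_sites I d \<tau> \<beta>)) = card (minima d A \<beta>)"
proof -
  have "minima d A \<beta> = \<tau> ` minima d A (permute_sites I d \<tau> \<beta>)"
  proof (intro equalityI subsetI)
    fix i assume i: "i \<in> minima d A \<beta>"
    then have "i \<in> \<tau> ` A"
      using minima_subset permutes_image[OF \<tau>] by blast
    then obtain k where "k \<in> A" "i = \<tau> k"
      by blast
    then show "i \<in> \<tau> ` minima d A (permute_sites I d \<tau> \<beta>)"
      using i mem_minima_permute_sites[OF assms, of k] by blast
  next
    fix i assume "i \<in> \<tau> ` minima d A (permute_sites I d \<tau> \<beta>)"
    then obtain k where "k \<in> minima d A (permute_sites I d \<tau> \<beta>)" "i = \<tau> k"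
      by blast
    then show "i \<in> minima d A \<beta>"
      using mem_minima_permute_sites[OF assms, of k] minima_subset by blast
  qed
  from arg_cong[OF this, of card] card_image[OF permutes_inj_on[OF \<tau>]] show ?thesis
    by (simp only:)
qed

section \<open>The product law and its invariance under permutations of the sites\<close>

text \<open>The law of the factor (i, j) depends on j alone; this is the source of
  exchangeability.\<close>

locale site_grid =
  fixes I :: "nat set" and D :: "nat \<Rightarrow> real measure"
  assumes finite_I: "finite I" and D: "\<And>j. real_distribution (D j)"
begin

abbreviation grid :: "nat \<Rightarrow> (nat \<times> nat \<Rightarrow> real) measure" where
  "grid d \<equiv> PiM (I \<times> {..<d}) (\<lambda>p. D (snd p))"

lemma sets_D [simp]: "sets (D j) = sets borel"
  using D real_distribution.events_eq_borel by blast

lemma prob_space_D: "prob_space (D j)"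
  using D real_distribution_def by blast

lemma prob_space_grid: "prob_space (grid d)"
  by (intro prob_space_PiM prob_space_D)

lemma pred_coord_le:
  assumes "k \<in> I" "i \<in> I" "d \<le> d'"
  shows "Measurable.pred (grid d') (\<lambda>\<beta>. coord_le d \<beta> k i)"
proof -
  have "(\<lambda>\<beta>. \<beta> (l, j)) \<in> borel_measurable (grid d')" if "l \<in> I" "j < d" for l j
    using that assms measurable_component_singleton[of "(l, j)" "I \<times> {..<d'}" "\<lambda>p. D (snd p)"]
    by (simp cong: measurable_cong_sets)
  then have "Measurable.pred (grid d') (\<lambda>\<beta>. \<forall>j\<in>{..<d}. \<beta> (k, j) \<le> \<beta> (i, j))"
    using assms unfolding pred_def
    by (intro sets.sets_Collect_finite_All borel_measurable_le) auto
  then show ?thesis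
    by (simp only: coord_le_def Ball_def lessThan_iff)
qed

lemma pred_undominated:
  assumes "A \<subseteq> I"
  shows "Measurable.pred (grid d) (\<lambda>\<beta>. i \<in> undominated d A h \<beta>)"
proof (cases "i \<in> A")
  case True
  have "Measurable.pred (grid d) (\<lambda>\<beta>. \<not> (\<exists>k\<in>A. k \<noteq> i \<and> h k \<le> h i \<and> coord_le d \<beta> k i))"
    using True assms finite_subset[OF assms finite_I]
    unfolding pred_def
    by (intro sets.sets_Collect_neg sets.sets_Collect_finite_Ex sets.sets_Collect_conj
        sets.sets_Collect_const pred_coord_le[unfolded pred_def]) auto
  then show ?thesis
    using True by (simp only: undominated_def mem_Collect_eq simp_thms)
next
  case False
  then show ?thesis
    by (simp only: undominated_def mem_Collect_eq simp_thms) (rule measurable_const, simp)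
qed

lemma pred_minima:
  assumes "A \<subseteq> I"
  shows "Measurable.pred (grid d) (\<lambda>\<beta>. i \<in> minima d A \<beta>)"
  using pred_undominated[OF assms, where d = d and i = i and h = "\<lambda>_. 0"]
  by (simp only: undominated_def minima_def order.refl simp_thms)

lemma measurable_card_undominated:
  assumes "A \<subseteq> I"
  shows "(\<lambda>\<beta>. card (undominated d A h \<beta>)) \<in> measurable (grid d) (count_space UNIV)"
  by (rule measurable_card, rule pred_undominated[OF assms, unfolded pred_def])

lemma measurable_card_minima:
  assumes "A \<subseteq> I"
  shows "(\<lambda>\<beta>. card (minima d A \<beta>)) \<in> measurable (grid d) (count_space UNIV)"
  by (rule measurable_card, rule pred_minima[OF assms, unfolded pred_def])

text \<open>The reindexing is injective and keeps the second index, hence the law of each factor, so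
  the product measure is invariant under it.\<close>

lemma nn_integral_permute_sites:
  assumes \<tau>: "\<tau> permutes I" and f: "f \<in> borel_measurable (grid d)"
  shows "(\<integral>\<^sup>+\<beta>. f (permute_sites I d \<tau> \<beta>) \<partial>grid d) = (\<integral>\<^sup>+\<beta>. f \<beta> \<partial>grid d)"
proof -
  let ?r = "\<lambda>p. (\<tau> (fst p), snd p)"
  have "inj_on ?r (I \<times> {..<d})"
    by (rule inj_onI) (auto dest: injD[OF permutes_inj[OF \<tau>]])
  moreover have "?r \<in> I \<times> {..<d} \<rightarrow> I \<times> {..<d}"
    by (auto simp: permutes_in_image[OF \<tau>])
  ultimately have "distr (grid d) (grid d) (permute_sites I d \<tau>) = grid d"
    using distr_PiM_reindex[of "I \<times> {..<d}" "\<lambda>p. D (snd p)" ?r "I \<times> {..<d}"] prob_space_D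
    by (simp only: permute_sites_def[abs_def] fst_conv snd_conv)
  moreover have "permute_sites I d \<tau> \<in> measurable (grid d) (grid d)"
  proof -
    have "(\<lambda>\<beta>. \<beta> (?r p)) \<in> measurable (grid d) (D (snd p))" if "p \<in> I \<times> {..<d}" for p
    proof -
      have "?r p \<in> I \<times> {..<d}"
        using that by (auto simp: permutes_in_image[OF \<tau>])
      from measurable_component_singleton[OF this, of "\<lambda>p. D (snd p)"] show ?thesis by simp
    qed
    then show ?thesis
      unfolding permute_sites_def[abs_def] by (intro measurable_restrict) auto
  qed
  ultimately show ?thesis
    using nn_integral_distr[of "permute_sites I d \<tau>" "grid d" "grid d" f] f by simp
qed

text \<open>A weight symmetric in \<open>A\<close> replaces conditioning on what happens after the
  sites of \<open>A\<close> are inserted: it may depend on all sites, but not on how the points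
  within \<open>A\<close> are assigned.\<close>

definition symmetric_on :: "nat \<Rightarrow> nat set \<Rightarrow> ((nat \<times> nat \<Rightarrow> real) \<Rightarrow> ennreal) \<Rightarrow> bool" where
  "symmetric_on d A f \<longleftrightarrow> (\<forall>\<tau> \<beta>. \<tau> permutes A \<longrightarrow> f (permute_sites I d \<tau> \<beta>) = f \<beta>)"

text \<open>Exchangeability: the site \<open>i\<close> is a minimum as often as any other site of \<open>A\<close>.\<close>

lemma nn_integral_symmetric_minima:
  assumes "A \<subseteq> I" "i \<in> A" and f [measurable]: "f \<in> borel_measurable (grid d)"
    and sym: "symmetric_on d A f"
  shows "of_nat (card A) * (\<integral>\<^sup>+\<beta>. f \<beta> * of_bool (i \<in> minima d A \<beta>) \<partial>grid d) =
    (\<integral>\<^sup>+\<beta>. f \<beta> * of_nat (card (minima d A \<beta>)) \<partial>grid d)"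
proof -
  have fin: "finite A"
    using assms(1) finite_I finite_subset by blast
  note [measurable] = pred_minima[OF assms(1)] measurable_card_minima[OF assms(1)]
  have meas [measurable]: "(\<lambda>\<beta>. f \<beta> * of_bool (k \<in> minima d A \<beta>)) \<in> borel_measurable (grid d)" for k
    by measurable
  have "(\<integral>\<^sup>+\<beta>. f \<beta> * of_bool (k \<in> minima d A \<beta>) \<partial>grid d) =
      (\<integral>\<^sup>+\<beta>. f \<beta> * of_bool (i \<in> minima d A \<beta>) \<partial>grid d)" if "k \<in> A" for k
  proof -
    \<comment> \<open>Swapping \<open>i\<close> and \<open>k\<close> turns "\<open>i\<close> is a
      minimum" into "\<open>k\<close> is a minimum" and leaves the weight unchanged, so all sites of
      \<open>A\<close> contribute the same integral. Summed over \<open>A\<close>, the indicators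
      give the number of minima.\<close>
    have \<tau>: "Transposition.transpose i k permutes A"
      by (rule permutes_swap_id) (fact assms(2), fact that)
    have "(\<integral>\<^sup>+\<beta>. f \<beta> * of_bool (i \<in> minima d A \<beta>) \<partial>grid d) =
        (\<integral>\<^sup>+\<beta>. f (permute_sites I d (Transposition.transpose i k) \<beta>) *
          of_bool (i \<in> minima d A (permute_sites I d (Transposition.transpose i k) \<beta>)) \<partial>grid d)"
      by (rule nn_integral_permute_sites[OF permutes_subset[OF \<tau> assms(1)] meas, symmetric])
    also have "\<dots> = (\<integral>\<^sup>+\<beta>. f \<beta> * of_bool (k \<in> minima d A \<beta>) \<partial>grid d)"
      using sym \<tau> assms by (simp add: symmetric_on_def mem_minima_permute_sites)
    finally show ?thesis ..
  qed
  then have "of_nat (card A) * (\<integral>\<^sup>+\<beta>. f \<beta> * of_bool (i \<in> minima d A \<beta>) \<partial>grid d) =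
      (\<Sum>k\<in>A. \<integral>\<^sup>+\<beta>. f \<beta> * of_bool (k \<in> minima d A \<beta>) \<partial>grid d)"
    by simp
  also have "\<dots> = (\<integral>\<^sup>+\<beta>. (\<Sum>k\<in>A. f \<beta> * of_bool (k \<in> minima d A \<beta>)) \<partial>grid d)"
    by (rule nn_integral_sum[symmetric]) measurable
  also have "\<dots> = (\<integral>\<^sup>+\<beta>. f \<beta> * of_nat (card (minima d A \<beta>)) \<partial>grid d)"
  proof (rule nn_integral_cong)
    fix \<beta>
    have "A \<inter> {k. k \<in> minima d A \<beta>} = minima d A \<beta>"
      using minima_subset by auto
    then show "(\<Sum>k\<in>A. f \<beta> * of_bool (k \<in> minima d A \<beta>)) = f \<beta> * of_nat (card (minima d A \<beta>))"
      using fin by (simp flip: sum_distrib_left)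
  qed
  finally show ?thesis .
qed

end

section \<open>Exponential moments\<close>

text \<open>Allows constants to be absorbed into powers of the logarithm: 1 \<le> 2 ln n.\<close>

lemma ln_ge_half:
  assumes "n \<ge> (2::nat)"
  shows "1 / 2 \<le> ln (real n)"
proof -
  have "(1::real) / 2 \<le> ln 2"
    using ln_le_minus_one[of "1 / 2 :: real"] by (simp add: ln_div)
  also have "\<dots> \<le> ln (real n)"
    using assms by simp
  finally show ?thesis .
qed

text \<open>\<open>harm n - ln n\<close> decreases from its value 1 at n = 1.\<close>

lemma harm_le_1_plus_ln:
  assumes "m \<le> n" "n > 0"
  shows "harm m \<le> (1 + ln (real n) :: real)"
proof -
  obtain k where n: "n = Suc k"
    using assms gr0_implies_Suc by blast
  have "harm m \<le> (harm n :: real)"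
    by (rule harm_mono) fact
  also have "harm n - ln (real n) \<le> 1"
    using decseq_harm_diff_ln[unfolded decseq_def, rule_format, of 0 k] by (simp add: n harm_expand)
  then have "harm n \<le> 1 + ln (real n)"
    by simp
  finally show ?thesis .
qed

lemma sorted_enumeration:
  fixes h :: "nat \<Rightarrow> real"
  assumes "finite A"
  obtains e where "bij_betw e {..<card A} A" "\<And>a b. a \<le> b \<Longrightarrow> b < card A \<Longrightarrow> h (e a) \<le> h (e b)"
proof -
  define xs where "xs = sort_key h (sorted_list_of_set A)"
  have xs: "distinct xs" "set xs = A" "length xs = card A" "sorted (map h xs)"
    using assms by (auto simp: xs_def)
  show thesis
  proof (rule that[of "\<lambda>a. xs ! a"])
    show "bij_betw (\<lambda>a. xs ! a) {..<card A} A"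
      using xs by (intro bij_betw_nth) auto
    show "h (xs ! a) \<le> h (xs ! b)" if "a \<le> b" "b < card A" for a b
      using that xs sorted_nth_mono[OF xs(4), of a b] by simp
  qed
qed

context site_grid
begin

text \<open>The exponential moment of a single step is controlled only where the number of minima is
  at most \<open>L\<close>; hence the truncation.\<close>

definition new_minimum ::
    "nat \<Rightarrow> real \<Rightarrow> nat set \<Rightarrow> nat \<Rightarrow> (nat \<times> nat \<Rightarrow> real) \<Rightarrow> bool" where
  "new_minimum d L A i \<beta> \<longleftrightarrow> i \<in> minima d A \<beta> \<and> real (card (minima d A \<beta>)) \<le> L"

lemma pred_new_minimum:
  assumes "A \<subseteq> I"
  shows "Measurable.pred (grid d) (new_minimum d L A i)"
proof -
  note [measurable] = pred_minima[OF assms] measurable_card_minima[OF assms]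
  show ?thesis
    unfolding new_minimum_def[abs_def] by measurable
qed

text \<open>By exchangeability the truncated event has weighted mass at most L / |A| times that of
  \<open>f\<close>. With e \<le> 3, the exponential of an indicator is at most 1 plus twice the
  indicator, and 1 + t \<le> exp t finishes.\<close>

lemma nn_integral_exp_new_minimum_le:
  assumes A: "A \<subseteq> I" "i \<in> A" and f [measurable]: "f \<in> borel_measurable (grid d)"
    and sym: "symmetric_on d A f" and "L \<ge> 0"
  shows "(\<integral>\<^sup>+\<beta>. f \<beta> * ennreal (exp (of_bool (new_minimum d L A i \<beta>))) \<partial>grid d) \<le>
    ennreal (exp (2 * L / card A)) * (\<integral>\<^sup>+\<beta>. f \<beta> \<partial>grid d)"
proof -
  note [measurable] = pred_minima[OF A(1)] measurable_card_minima[OF A(1)] pred_new_minimum[OF A(1)]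
  have m: "card A > 0"
    using A finite_I finite_subset by (auto simp: card_gt_0_iff)
  define F where "F = (\<integral>\<^sup>+\<beta>. f \<beta> \<partial>grid d)"
  \<comment> \<open>The truncation moves into the weight: the number of minima of \<open>A\<close>
    is invariant under permutations of \<open>A\<close>, so \<open>g\<close> is still
    symmetric.\<close>
  define g where "g = (\<lambda>\<beta>. f \<beta> * of_bool (real (card (minima d A \<beta>)) \<le> L))"
  have g [measurable]: "g \<in> borel_measurable (grid d)"
    unfolding g_def by measurable
  have "symmetric_on d A g"
    using sym A(1) by (simp add: symmetric_on_def g_def card_minima_permute_sites)
  define c where "c = (\<integral>\<^sup>+\<beta>. g \<beta> * of_bool (i \<in> minima d A \<beta>) \<partial>grid d)"
  have "of_nat (card A) * c = (\<integral>\<^sup>+\<beta>. g \<beta> * of_nat (card (minima d A \<beta>)) \<partial>grid d)"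
    unfolding c_def by (rule nn_integral_symmetric_minima) fact+
  also have "\<dots> \<le> (\<integral>\<^sup>+\<beta>. ennreal L * f \<beta> \<partial>grid d)"
  proof (rule nn_integral_mono)
    fix \<beta>
    show "g \<beta> * of_nat (card (minima d A \<beta>)) \<le> ennreal L * f \<beta>"
    proof (cases "real (card (minima d A \<beta>)) \<le> L")
      case True
      then have "of_nat (card (minima d A \<beta>)) \<le> ennreal L"
        by (simp add: ennreal_of_nat_eq_real_of_nat ennreal_leI)
      from mult_right_mono[OF this, of "f \<beta>"] True show ?thesis
        by (simp add: g_def mult.commute)
    qed (simp add: g_def)
  qed
  also have "\<dots> = ennreal L * F"
    unfolding F_def by (rule nn_integral_cmult) measurable
  finally have mc: "of_nat (card A) * c \<le> ennreal L * F" .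
  have one: "ennreal (1 / card A) * of_nat (card A) = 1"
    using m by (simp add: ennreal_of_nat_eq_real_of_nat flip: ennreal_mult)
  have "c = ennreal (1 / card A) * (of_nat (card A) * c)"
    by (simp only: one mult_1 flip: mult.assoc)
  also have "\<dots> \<le> ennreal (1 / card A) * (ennreal L * F)"
    by (intro mult_left_mono mc) simp
  also have "\<dots> = ennreal (L / card A) * F"
    using \<open>L \<ge> 0\<close> by (simp flip: mult.assoc ennreal_mult)
  finally have c: "c \<le> ennreal (L / card A) * F" .
  have "(\<integral>\<^sup>+\<beta>. f \<beta> * ennreal (exp (of_bool (new_minimum d L A i \<beta>))) \<partial>grid d) \<le>
      (\<integral>\<^sup>+\<beta>. f \<beta> + 2 * (g \<beta> * of_bool (i \<in> minima d A \<beta>)) \<partial>grid d)"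
  proof (rule nn_integral_mono)
    fix \<beta>
    have "ennreal (exp 1) \<le> ennreal 3"
      using exp_le by (intro ennreal_leI) simp
    also have "\<dots> = 1 + 2"
      by simp
    finally have "f \<beta> * ennreal (exp 1) \<le> f \<beta> * (1 + 2)"
      by (intro mult_left_mono) auto
    then have "f \<beta> * ennreal (exp 1) \<le> f \<beta> + 2 * f \<beta>"
      by (simp only: distrib_left mult.right_neutral mult.commute[of 2])
    then show "f \<beta> * ennreal (exp (of_bool (new_minimum d L A i \<beta>))) \<le>
        f \<beta> + 2 * (g \<beta> * of_bool (i \<in> minima d A \<beta>))"
      by (cases "new_minimum d L A i \<beta>") (auto simp: new_minimum_def g_def)
  qed
  also have "\<dots> = F + 2 * c"
    unfolding F_def c_def by (subst nn_integral_add) (auto simp: nn_integral_cmult)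
  also have "\<dots> \<le> F + 2 * (ennreal (L / card A) * F)"
    by (intro add_mono mult_left_mono c) auto
  also have "\<dots> = (1 + 2 * ennreal (L / card A)) * F"
    by (simp only: distrib_right mult_1 mult.assoc)
  also have "1 + 2 * ennreal (L / card A) = ennreal (1 + 2 * L / card A)"
    using ennreal_plus[of 1 "2 * (L / card A)"] ennreal_mult'[of 2 "L / card A"] \<open>L \<ge> 0\<close>
    by simp
  also have "\<dots> * F \<le> ennreal (exp (2 * L / card A)) * F"
    by (intro mult_right_mono ennreal_leI exp_ge_add_one_self) auto
  finally show ?thesis
    by (simp only: F_def)
qed

text \<open>Peeling off the last site first keeps the weight \<open>f\<close> symmetric in the sites that remain.\<close>

lemma nn_integral_exp_sum_new_minimum_le:
  assumes "inj_on e {..<m}" "e ` {..<m} \<subseteq> I" and f: "f \<in> borel_measurable (grid d)"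
    and "symmetric_on d (e ` {..<m}) f" and "L \<ge> 0"
  shows "(\<integral>\<^sup>+\<beta>. f \<beta> * ennreal (exp (\<Sum>a<m. of_bool (new_minimum d L (e ` {..a}) (e a) \<beta>))) \<partial>grid d)
    \<le> ennreal (exp (2 * L * harm m)) * (\<integral>\<^sup>+\<beta>. f \<beta> \<partial>grid d)"
  using assms
proof (induction m arbitrary: f)
  case 0
  then show ?case
    by (simp add: harm_def)
next
  case (Suc m)
  let ?A = "e ` {..m}"
  let ?w = "\<lambda>\<beta>. ennreal (exp (of_bool (new_minimum d L ?A (e m) \<beta>)))"
  let ?S = "\<lambda>\<beta>. (\<Sum>a<m. of_bool (new_minimum d L (e ` {..a}) (e a) \<beta>)) :: real"
  have A: "?A \<subseteq> I" "symmetric_on d ?A f" "card ?A = Suc m"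
    using Suc.prems by (simp_all add: lessThan_Suc_atMost card_image)
  have not_mem: "e m \<notin> e ` {..<m}"
    using inj_onD[OF Suc.prems(1), of m] by force
  note [measurable] = Suc.prems(3) pred_new_minimum[OF A(1)]
  \<comment> \<open>A permutation of the earlier sites fixes \<open>e m\<close> and permutes the
    whole prefix \<open>?A\<close>, so neither the minimality of \<open>e m\<close> nor the number
    of minima in \<open>?A\<close> changes.\<close>
  have "symmetric_on d (e ` {..<m}) (\<lambda>\<beta>. f \<beta> * ?w \<beta>)"
    unfolding symmetric_on_def
  proof (intro allI impI)
    fix \<tau> \<beta> assume \<tau>: "\<tau> permutes e ` {..<m}"
    then have "\<tau> permutes ?A"
      by (rule permutes_subset) auto
    moreover have "\<tau> (e m) = e m"
      by (rule permutes_not_in[OF \<tau> not_mem])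
    ultimately show "f (permute_sites I d \<tau> \<beta>) * ?w (permute_sites I d \<tau> \<beta>) = f \<beta> * ?w \<beta>"
      using A by (simp add: symmetric_on_def new_minimum_def card_minima_permute_sites
          mem_minima_permute_sites)
  qed
  moreover have "(\<lambda>\<beta>. f \<beta> * ?w \<beta>) \<in> borel_measurable (grid d)"
    by measurable
  moreover have "inj_on e {..<m}" "e ` {..<m} \<subseteq> I"
    using Suc.prems by (auto simp: inj_on_def)
  ultimately have IH: "(\<integral>\<^sup>+\<beta>. f \<beta> * ?w \<beta> * ennreal (exp (?S \<beta>)) \<partial>grid d) \<le>
      ennreal (exp (2 * L * harm m)) * (\<integral>\<^sup>+\<beta>. f \<beta> * ?w \<beta> \<partial>grid d)"
    using Suc.IH[of "\<lambda>\<beta>. f \<beta> * ?w \<beta>"] Suc.prems(5) by blast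
  have "f \<beta> * ennreal (exp (\<Sum>a<Suc m. of_bool (new_minimum d L (e ` {..a}) (e a) \<beta>))) =
      f \<beta> * ?w \<beta> * ennreal (exp (?S \<beta>))" for \<beta>
    by (simp only: sum.lessThan_Suc exp_add ennreal_mult' exp_ge_zero ac_simps)
  then have "(\<integral>\<^sup>+\<beta>. f \<beta> * ennreal (exp (\<Sum>a<Suc m. of_bool (new_minimum d L (e ` {..a}) (e a) \<beta>)))
      \<partial>grid d) \<le> ennreal (exp (2 * L * harm m)) * (\<integral>\<^sup>+\<beta>. f \<beta> * ?w \<beta> \<partial>grid d)"
    using IH by (simp only:)
  also have "\<dots> \<le> ennreal (exp (2 * L * harm m)) *
      (ennreal (exp (2 * L / Suc m)) * (\<integral>\<^sup>+\<beta>. f \<beta> \<partial>grid d))"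
    using nn_integral_exp_new_minimum_le[OF A(1) _ Suc.prems(3) A(2) Suc.prems(5), of "e m"]
    unfolding A(3) by (intro mult_left_mono) auto
  also have "\<dots> = ennreal (exp (2 * L * harm (Suc m))) * (\<integral>\<^sup>+\<beta>. f \<beta> \<partial>grid d)"
    by (simp add: harm_Suc distrib_left exp_add ennreal_mult divide_inverse flip: mult.assoc)
  finally show ?case .
qed

text \<open>Chernoff's bound with parameter 1; the moment estimate is applied to the constant weight
  1, which is symmetric.\<close>

lemma emeasure_sum_new_minimum_ge:
  assumes "inj_on e {..<m}" and A: "e ` {..<m} \<subseteq> I" and "L \<ge> 0"
  shows "emeasure (grid d) {\<beta> \<in> space (grid d).
      (\<Sum>a<m. of_bool (new_minimum d L (e ` {..a}) (e a) \<beta>)) \<ge> K} \<le> ennreal (exp (2 * L * harm m - K))"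
proof -
  let ?S = "\<lambda>\<beta>. (\<Sum>a<m. of_bool (new_minimum d L (e ` {..a}) (e a) \<beta>)) :: real"
  interpret prob_space "grid d"
    by (rule prob_space_grid)
  have "?S \<in> borel_measurable (grid d)"
  proof (rule borel_measurable_sum)
    fix a assume "a \<in> {..<m}"
    then have "e ` {..a} \<subseteq> I"
      using A by auto
    note [measurable] = pred_new_minimum[OF this]
    show "(\<lambda>\<beta>. of_bool (new_minimum d L (e ` {..a}) (e a) \<beta>) :: real) \<in> borel_measurable (grid d)"
      by measurable
  qed
  then have "emeasure (grid d) {\<beta> \<in> space (grid d). ?S \<beta> \<ge> K} \<le>
      ennreal (exp (- 1 * K)) * (\<integral>\<^sup>+\<beta>. ennreal (exp (1 * ?S \<beta>)) * indicator (space (grid d)) \<beta> \<partial>grid d)"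
    by (intro Chernoff_ineq_nn_integral_ge) auto
  also have "(\<integral>\<^sup>+\<beta>. ennreal (exp (1 * ?S \<beta>)) * indicator (space (grid d)) \<beta> \<partial>grid d) =
      (\<integral>\<^sup>+\<beta>. 1 * ennreal (exp (?S \<beta>)) \<partial>grid d)"
    by (intro nn_integral_cong) simp
  also have "\<dots> \<le> ennreal (exp (2 * L * harm m)) * (\<integral>\<^sup>+\<beta>. 1 \<partial>grid d)"
    using assms by (intro nn_integral_exp_sum_new_minimum_le) (auto simp: symmetric_on_def)
  also have "\<dots> = ennreal (exp (2 * L * harm m))"
    by (simp add: emeasure_space_1)
  also have "ennreal (exp (- 1 * K)) * \<dots> = ennreal (exp (2 * L * harm m - K))"
    by (simp add: exp_diff exp_minus field_simps flip: ennreal_mult)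
  finally show ?thesis
    by (simp add: mult_left_mono)
qed

end

section \<open>Tail bounds for one fixed order\<close>

text \<open>Earlier sites have no larger \<open>h\<close>, so being dominated within the prefix
  already rules a site out. With ties in \<open>h\<close> a later site may dominate as well, hence
  only an inclusion.\<close>

lemma undominated_subset_new_minima:
  fixes e :: "nat \<Rightarrow> nat" and h :: "nat \<Rightarrow> real"
  assumes e: "bij_betw e {..<m} A" and h: "\<And>a b. a \<le> b \<Longrightarrow> b < m \<Longrightarrow> h (e a) \<le> h (e b)"
  shows "undominated d A h \<beta> \<subseteq> e ` {a. a < m \<and> e a \<in> minima d (e ` {..a}) \<beta>}"
proof
  fix i assume i: "i \<in> undominated d A h \<beta>"
  have A: "A = e ` {..<m}"
    using e by (simp add: bij_betw_def)
  obtain a where a: "a < m" "i = e a"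
    using i A undominated_subset by blast
  have "e a \<in> minima d (e ` {..a}) \<beta>"
    unfolding minima_def mem_Collect_eq
  proof (intro conjI notI)
    assume "\<exists>k\<in>e ` {..a}. k \<noteq> e a \<and> coord_le d \<beta> k (e a)"
    then obtain b where "b \<le> a" "e b \<noteq> e a" "coord_le d \<beta> (e b) (e a)"
      by auto
    moreover from this have "e b \<in> A"
      unfolding A using a(1) by (intro imageI) simp
    ultimately have "\<not> h (e b) \<le> h (e a)"
      using i a by (auto simp: undominated_def)
    then show False
      using h[OF \<open>b \<le> a\<close> a(1)] by contradiction
  qed simp
  then show "i \<in> e ` {a. a < m \<and> e a \<in> minima d (e ` {..a}) \<beta>}"
    using a by blast
qed

context site_grid
begin

lemma emeasure_minima_Suc_le:
  assumes A: "A \<subseteq> I"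
    and bound: "\<And>h. emeasure (grid d) {\<beta> \<in> space (grid d). real (card (undominated d A h \<beta>)) > L} \<le> p"
  shows "emeasure (grid (Suc d)) {\<beta> \<in> space (grid (Suc d)). real (card (minima (Suc d) A \<beta>)) > L} \<le> p"
proof -
  interpret product_sigma_finite "\<lambda>p::nat \<times> nat. D (snd p)"
    using product_prob_spaceI[of "\<lambda>p::nat \<times> nat. D (snd p)"] prob_space_D product_prob_space_def by blast
  let ?col = "PiM (I \<times> {d}) (\<lambda>p. D (snd p))"
  define B where "B = {\<beta> \<in> space (grid (Suc d)). real (card (minima (Suc d) A \<beta>)) > L}"
  have B: "B \<in> sets (grid (Suc d))"
  proof -
    note [measurable] = measurable_card_minima[OF A]
    show ?thesis
      unfolding B_def by measurable
  qed
  \<comment> \<open>The last column comes first in the union because the first index set is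
    integrated outermost.\<close>
  have grid_Suc: "I \<times> {..<Suc d} = I \<times> {d} \<union> I \<times> {..<d}"
    by auto
  have "emeasure (grid (Suc d)) B = (\<integral>\<^sup>+\<beta>. indicator B \<beta> \<partial>grid (Suc d))"
    using B by simp
  also have "\<dots> = (\<integral>\<^sup>+y. (\<integral>\<^sup>+\<beta>. indicator B (merge (I \<times> {d}) (I \<times> {..<d}) (y, \<beta>)) \<partial>grid d) \<partial>?col)"
    unfolding grid_Suc
    by (rule product_nn_integral_fold) (use finite_I B in \<open>auto simp flip: grid_Suc\<close>)
  also have "\<dots> \<le> (\<integral>\<^sup>+y. p \<partial>?col)"
  proof (rule nn_integral_mono)
    fix y :: "nat \<times> nat \<Rightarrow> real"
    let ?h = "\<lambda>i. y (i, d)"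
    let ?U = "{\<beta> \<in> space (grid d). real (card (undominated d A ?h \<beta>)) > L}"
    have "(\<integral>\<^sup>+\<beta>. indicator B (merge (I \<times> {d}) (I \<times> {..<d}) (y, \<beta>)) \<partial>grid d) \<le>
        (\<integral>\<^sup>+\<beta>. indicator ?U \<beta> \<partial>grid d)"
    proof (rule nn_integral_mono)
      fix \<beta> assume \<beta>: "\<beta> \<in> space (grid d)"
      let ?m = "merge (I \<times> {d}) (I \<times> {..<d}) (y, \<beta>)"
      have "?m (i, d) = y (i, d)" "j < d \<Longrightarrow> ?m (i, j) = \<beta> (i, j)" if "i \<in> A" for i j
        using that A by (auto simp: merge_def)
      then have "minima (Suc d) A ?m = undominated d A ?h \<beta>"
        unfolding minima_Suc_eq_undominated by (auto simp: undominated_def coord_le_def)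
      then show "indicator B ?m \<le> (indicator ?U \<beta> :: ennreal)"
        using \<beta> by (simp add: B_def indicator_def)
    qed
    also have "\<dots> = emeasure (grid d) ?U"
    proof -
      note [measurable] = measurable_card_undominated[OF A]
      show ?thesis
        by (rule nn_integral_indicator) measurable
    qed
    finally show "(\<integral>\<^sup>+\<beta>. indicator B (merge (I \<times> {d}) (I \<times> {..<d}) (y, \<beta>)) \<partial>grid d) \<le> p"
      using bound[of ?h] by (rule order.trans)
  qed
  also have "\<dots> = p"
    using prob_space.emeasure_space_1[OF prob_space_PiM[of "I \<times> {d}" "\<lambda>p. D (snd p)"]] prob_space_D
    by simp
  finally show ?thesis
    unfolding B_def .
qed

text \<open>Either one of the at most n prefixes has more than \<open>L\<close> minima
  (\<open>V\<close>), or the truncation is inactive and the sum of truncated indicators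
  \<open>S\<close>, which then bounds the number of undominated sites, must be large
  (\<open>W\<close>).\<close>

lemma emeasure_undominated_le:
  assumes A: "A \<subseteq> I" "card A \<le> n" and n: "n > 0" and "L \<ge> 0"
    and bound: "\<And>A'. A' \<subseteq> A \<Longrightarrow>
      emeasure (grid d) {\<beta> \<in> space (grid d). real (card (minima d A' \<beta>)) > L} \<le> ennreal p"
  shows "emeasure (grid d) {\<beta> \<in> space (grid d). real (card (undominated d A h \<beta>)) > K} \<le>
    of_nat n * ennreal p + ennreal (exp (2 * L * (1 + ln (real n)) - K))"
proof -
  have fin: "finite A"
    using A finite_I finite_subset by blast
  obtain e where e: "bij_betw e {..<card A} A" "\<And>a b. a \<le> b \<Longrightarrow> b < card A \<Longrightarrow> h (e a) \<le> h (e b)"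
    using sorted_enumeration[OF fin] by metis
  define m where "m = card A"
  have im: "e ` {..<m} = A" "inj_on e {..<m}"
    using e by (simp_all add: bij_betw_def m_def)
  define S where "S \<beta> = (\<Sum>a<m. of_bool (new_minimum d L (e ` {..a}) (e a) \<beta>) :: real)" for \<beta>
  define V where "V a = {\<beta> \<in> space (grid d). real (card (minima d (e ` {..a}) \<beta>)) > L}" for a
  define W where "W = {\<beta> \<in> space (grid d). S \<beta> \<ge> K}"
  have prefix: "e ` {..a} \<subseteq> A" if "a < m" for a
    using that im by auto
  have V: "V a \<in> sets (grid d)" if "a < m" for a
  proof -
    note [measurable] = measurable_card_minima[OF subset_trans[OF prefix[OF that] A(1)]]
    show ?thesis
      unfolding V_def by measurable
  qed
  have W: "W \<in> sets (grid d)"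
  proof -
    have "S \<in> borel_measurable (grid d)"
      unfolding S_def
    proof (rule borel_measurable_sum)
      fix a assume "a \<in> {..<m}"
      then have "e ` {..a} \<subseteq> I"
        using prefix A by blast
      note [measurable] = pred_new_minimum[OF this]
      show "(\<lambda>\<beta>. of_bool (new_minimum d L (e ` {..a}) (e a) \<beta>) :: real) \<in> borel_measurable (grid d)"
        by measurable
    qed
    then show ?thesis
      unfolding W_def by measurable
  qed
  have "{\<beta> \<in> space (grid d). real (card (undominated d A h \<beta>)) > K} \<subseteq> (\<Union>a<m. V a) \<union> W"
  proof
    fix \<beta> assume \<beta>: "\<beta> \<in> {\<beta> \<in> space (grid d). real (card (undominated d A h \<beta>)) > K}"
    show "\<beta> \<in> (\<Union>a<m. V a) \<union> W"
    proof (cases "\<beta> \<in> (\<Union>a<m. V a)")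
      case False
      let ?N = "{a. a < m \<and> e a \<in> minima d (e ` {..a}) \<beta>}"
      have new: "new_minimum d L (e ` {..a}) (e a) \<beta> \<longleftrightarrow> e a \<in> minima d (e ` {..a}) \<beta>" if "a < m" for a
        using False \<beta> that by (auto simp: V_def new_minimum_def not_less)
      have "card (undominated d A h \<beta>) \<le> card (e ` ?N)"
        using undominated_subset_new_minima[where e = e and h = h, OF e] by (intro card_mono) (auto simp: m_def)
      also have "\<dots> \<le> card ?N"
        by (rule card_image_le) simp
      finally have "real (card (undominated d A h \<beta>)) \<le> real (card ?N)"
        by simp
      also have "\<dots> = (\<Sum>a<m. of_bool (e a \<in> minima d (e ` {..a}) \<beta>))"
        by (simp add: Int_def)
      also have "\<dots> = S \<beta>"
        unfolding S_def by (intro sum.cong) (simp_all add: new)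
      finally show ?thesis
        using \<beta> by (simp add: W_def)
    qed simp
  qed
  then have "emeasure (grid d) {\<beta> \<in> space (grid d). real (card (undominated d A h \<beta>)) > K} \<le>
      emeasure (grid d) ((\<Union>a<m. V a) \<union> W)"
    using V W by (intro emeasure_mono) auto
  also have "\<dots> \<le> emeasure (grid d) (\<Union>a<m. V a) + emeasure (grid d) W"
    using V W by (intro emeasure_subadditive) auto
  also have "\<dots> \<le> (\<Sum>a<m. emeasure (grid d) (V a)) + emeasure (grid d) W"
    using V by (intro add_mono emeasure_subadditive_finite) auto
  also have "(\<Sum>a<m. emeasure (grid d) (V a)) \<le> (\<Sum>a<m. ennreal p)"
    unfolding V_def using prefix by (intro sum_mono bound) auto
  also have "\<dots> \<le> of_nat n * ennreal p"
    using A by (auto simp: m_def intro!: mult_right_mono)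
  also have "emeasure (grid d) W \<le> ennreal (exp (2 * L * harm m - K))"
    unfolding W_def S_def using im A \<open>L \<ge> 0\<close> by (intro emeasure_sum_new_minimum_ge) auto
  also have "\<dots> \<le> ennreal (exp (2 * L * (1 + ln (real n)) - K))"
    using A n \<open>L \<ge> 0\<close> harm_le_1_plus_ln[of m n]
    by (intro ennreal_leI) (auto simp: m_def intro!: mult_left_mono)
  finally show ?thesis
    by (simp add: add_mono)
qed

end

section \<open>The induction on the dimension\<close>

text \<open>\<open>C\<close> is chosen before sites, laws and order, so it depends on \<gamma> and d
  only. The induction step uses the exponent \<gamma> + 2: the union over at most n prefixes costs
  one factor n, and the sum of two equal error terms is absorbed by another, since 2 \<le>
  n.\<close>

lemma undominated_whp:
  fixes \<gamma> :: real
  assumes "\<gamma> \<ge> 0"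
  shows "\<exists>C\<ge>0. \<forall>I D A n h. site_grid I D \<longrightarrow> n \<ge> 2 \<longrightarrow> A \<subseteq> I \<longrightarrow> card A \<le> n \<longrightarrow>
    emeasure (site_grid.grid I D d) {\<beta> \<in> space (site_grid.grid I D d).
      real (card (undominated d A h \<beta>)) > C * ln (real n) ^ d} \<le> ennreal (real n powr (- \<gamma>))"
  using assms
proof (induction d arbitrary: \<gamma>)
  case 0
  \<comment> \<open>In dimension 0 \<open>coord_le\<close> is vacuous and any two sites are
    comparable by \<open>h\<close>, so at most one is undominated and the constant 1 works.\<close>
  have "\<not> Suc 0 < card (undominated 0 A h \<beta>)" for A :: "nat set" and h \<beta>
  proof -
    have "i = k" if "i \<in> undominated 0 A h \<beta>" "k \<in> undominated 0 A h \<beta>" for i k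
      using that linear[of "h i" "h k"] by (auto simp: undominated_def coord_le_def)
    then have "undominated 0 A h \<beta> = {} \<or> (\<exists>i. undominated 0 A h \<beta> = {i})"
      by blast
    then show ?thesis
      by auto
  qed
  then show ?case
    by (intro exI[of _ 1]) simp
next
  case (Suc d)
  obtain C' where "C' \<ge> 0" and C': "\<And>I D A n h. site_grid I D \<Longrightarrow> n \<ge> 2 \<Longrightarrow> A \<subseteq> I \<Longrightarrow> card A \<le> n \<Longrightarrow>
      emeasure (site_grid.grid I D d) {\<beta> \<in> space (site_grid.grid I D d).
        real (card (undominated d A h \<beta>)) > C' * ln (real n) ^ d} \<le> ennreal (real n powr (- (\<gamma> + 2)))"
    using Suc.IH[of "\<gamma> + 2"] Suc.prems by auto
  \<comment> \<open>Write l = ln n. The first summand absorbs 2 L (1 + l) \<le> 6 C' l^(d + 1), as 1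
    + l \<le> 3 l. The second leaves at least (\<gamma> + 1) l in the exponent, as (2 l)^d \<ge>
    1.\<close>
  define C where "C = 6 * C' + (\<gamma> + 1) * 2 ^ d"
  show ?case
  proof (intro exI[of _ C] conjI allI impI)
    show "0 \<le> C"
      using \<open>C' \<ge> 0\<close> Suc.prems by (simp add: C_def)
    fix I D A h and n :: nat
    assume "site_grid I D" and n: "n \<ge> 2" and A: "A \<subseteq> I" "card A \<le> n"
    interpret site_grid I D by fact
    have fin: "finite A"
      using A finite_I finite_subset by blast
    define l where "l = ln (real n)"
    have l: "l \<ge> 1 / 2"
      unfolding l_def using n by (rule ln_ge_half)
    let ?L = "C' * l ^ d"
    have L: "?L \<ge> 0"
      using l \<open>C' \<ge> 0\<close> by simp
    have tail: "emeasure (grid (Suc d)) {\<beta> \<in> space (grid (Suc d)). real (card (minima (Suc d) A' \<beta>)) > ?L}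
        \<le> ennreal (real n powr (- (\<gamma> + 2)))" if "A' \<subseteq> A" for A'
    proof (rule emeasure_minima_Suc_le)
      show "A' \<subseteq> I"
        using that A by blast
      then show "emeasure (grid d) {\<beta> \<in> space (grid d). real (card (undominated d A' h \<beta>)) > ?L}
          \<le> ennreal (real n powr (- (\<gamma> + 2)))" for h
        unfolding l_def using card_mono[OF fin that] A n
        by (intro C' \<open>site_grid I D\<close>) auto
    qed
    have exponent: "2 * ?L * (1 + l) - C * l ^ Suc d \<le> - (\<gamma> + 1) * l"
    proof -
      have "2 * ?L * (1 + l) \<le> 2 * ?L * (3 * l)"
        using l L by (intro mult_left_mono) auto
      moreover have "1 \<le> (2 * l) ^ d"
        using l by (intro one_le_power) simp
      then have "(\<gamma> + 1) * l * 1 \<le> (\<gamma> + 1) * l * (2 * l) ^ d"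
        using Suc.prems l by (intro mult_left_mono) auto
      ultimately show ?thesis
        by (simp add: C_def algebra_simps power_mult_distrib)
    qed
    have "emeasure (grid (Suc d)) {\<beta> \<in> space (grid (Suc d)).
        real (card (undominated (Suc d) A h \<beta>)) > C * l ^ Suc d} \<le>
      of_nat n * ennreal (real n powr (- (\<gamma> + 2))) + ennreal (exp (2 * ?L * (1 + l) - C * l ^ Suc d))"
      unfolding l_def
      by (rule emeasure_undominated_le) (use A n L tail in \<open>auto simp: l_def\<close>)
    also have "\<dots> \<le> of_nat n * ennreal (real n powr (- (\<gamma> + 2))) + ennreal (exp (- (\<gamma> + 1) * l))"
      using exponent by (intro add_left_mono ennreal_leI) simp
    also have "\<dots> = ennreal (real n * real n powr (- (\<gamma> + 2)) + real n powr (- (\<gamma> + 1)))"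
      using n by (simp add: ennreal_of_nat_eq_real_of_nat powr_def l_def ennreal_plus ennreal_mult)
    also have "\<dots> \<le> ennreal (real n powr (- \<gamma>))"
    proof (rule ennreal_leI)
      have exponents: "1 + - (\<gamma> + 2) = - (\<gamma> + 1)" "1 + - (\<gamma> + 1) = - \<gamma>"
        by simp_all
      have 1: "real n * real n powr (- (\<gamma> + 2)) = real n powr (- (\<gamma> + 1))"
        using powr_mult_base[of "real n" "- (\<gamma> + 2)"] by (simp only: exponents of_nat_0_le_iff simp_thms)
      have 2: "real n powr (- \<gamma>) = real n * real n powr (- (\<gamma> + 1))"
        using powr_mult_base[of "real n" "- (\<gamma> + 1)"] by (simp only: exponents of_nat_0_le_iff simp_thms)
      have "2 * real n powr (- (\<gamma> + 1)) \<le> real n * real n powr (- (\<gamma> + 1))"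
        using n by (intro mult_right_mono) auto
      then show "real n * real n powr (- (\<gamma> + 2)) + real n powr (- (\<gamma> + 1)) \<le> real n powr (- \<gamma>)"
        unfolding 1 2 by simp
    qed
    finally show "emeasure (grid (Suc d)) {\<beta> \<in> space (grid (Suc d)).
        real (card (undominated (Suc d) A h \<beta>)) > C * ln (real n) ^ Suc d} \<le> ennreal (real n powr (- \<gamma>))"
      by (simp only: l_def)
  qed
qed

section \<open>Candidate sets\<close>

definition uncurry_sites ::
    "nat \<Rightarrow> nat \<Rightarrow> (nat \<Rightarrow> nat \<Rightarrow> real) \<Rightarrow> nat \<times> nat \<Rightarrow> real" where
  "uncurry_sites n d \<beta> = (\<lambda>p\<in>{..<n} \<times> {..<d}. \<beta> (fst p) (snd p))"

lemma measurable_sampling_model_component: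
  assumes "i < n" "j < d"
  shows "(\<lambda>\<beta>. \<beta> i j) \<in> measurable (sampling_model d n D) (D j)"
  unfolding sampling_model_def
  by (rule measurable_compose[OF measurable_component_singleton[of i "{..<n}" "\<lambda>_. PiM {..<d} D"]
        measurable_component_singleton[of j "{..<d}" D]]) (use assms in auto)

lemma measurable_uncurry_sites:
  "uncurry_sites n d \<in> measurable (sampling_model d n D) (PiM ({..<n} \<times> {..<d}) (\<lambda>p. D (snd p)))"
  unfolding uncurry_sites_def[abs_def]
  by (intro measurable_restrict measurable_sampling_model_component) auto

text \<open>Boxes determine a finite product measure, and the preimage of a box is a nested box
  whose measure is the same product of factors.\<close>

lemma distr_sampling_model_uncurry_sites:
  assumes D: "\<And>j. prob_space (D j)"
  shows "distr (sampling_model d n D) (PiM ({..<n} \<times> {..<d}) (\<lambda>p. D (snd p))) (uncurry_sites n d) =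
    PiM ({..<n} \<times> {..<d}) (\<lambda>p. D (snd p))"
proof -
  let ?G = "PiM ({..<n} \<times> {..<d}) (\<lambda>p. D (snd p))"
  interpret G: product_sigma_finite "\<lambda>p::nat \<times> nat. D (snd p)"
    using product_prob_spaceI[of "\<lambda>p::nat \<times> nat. D (snd p)"] D product_prob_space_def by blast
  interpret point: product_sigma_finite D
    using product_prob_spaceI[of D] D product_prob_space_def by blast
  interpret sample: product_sigma_finite "\<lambda>_::nat. PiM {..<d} D"
    using product_prob_spaceI[of "\<lambda>_::nat. PiM {..<d} D"] prob_space_PiM[of "{..<d}" D] D
      product_prob_space_def by blast
  show ?thesis
  proof (rule G.PiM_eqI)
    fix E assume E: "\<And>p. p \<in> {..<n} \<times> {..<d} \<Longrightarrow> E p \<in> sets (D (snd p))"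
    then have E': "E (i, j) \<in> sets (D j)" if "i < n" "j < d" for i j
      using that by force
    have "uncurry_sites n d -` (Pi\<^sub>E ({..<n} \<times> {..<d}) E) \<inter> space (sampling_model d n D) =
        (\<Pi>\<^sub>E i\<in>{..<n}. \<Pi>\<^sub>E j\<in>{..<d}. E (i, j))" (is "?L = ?R")
    proof (intro equalityI subsetI)
      fix \<beta> assume "\<beta> \<in> ?L"
      then show "\<beta> \<in> ?R"
        by (auto simp: uncurry_sites_def sampling_model_def space_PiM PiE_iff restrict_def)
    next
      fix \<beta> assume \<beta>: "\<beta> \<in> ?R"
      then have "\<beta> i j \<in> space (D j)" if "i < n" "j < d" for i j
        using E'[OF that, THEN sets.sets_into_space] that by (auto simp: PiE_iff)
      with \<beta> show "\<beta> \<in> ?L"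
        by (auto simp: uncurry_sites_def sampling_model_def space_PiM PiE_iff)
    qed
    moreover have "Pi\<^sub>E ({..<n} \<times> {..<d}) E \<in> sets ?G"
      using E by (intro sets_PiM_I_finite) auto
    ultimately have "emeasure (distr (sampling_model d n D) ?G (uncurry_sites n d)) (Pi\<^sub>E ({..<n} \<times> {..<d}) E) =
        emeasure (sampling_model d n D) (\<Pi>\<^sub>E i\<in>{..<n}. \<Pi>\<^sub>E j\<in>{..<d}. E (i, j))"
      by (simp add: emeasure_distr[OF measurable_uncurry_sites])
    also have "\<dots> = (\<Prod>i<n. emeasure (PiM {..<d} D) (\<Pi>\<^sub>E j\<in>{..<d}. E (i, j)))"
      unfolding sampling_model_def using E' by (intro sample.emeasure_PiM sets_PiM_I_finite) auto
    also have "\<dots> = (\<Prod>i<n. \<Prod>j<d. emeasure (D j) (E (i, j)))"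
      using E' by (intro prod.cong point.emeasure_PiM) auto
    also have "\<dots> = (\<Prod>p\<in>{..<n} \<times> {..<d}. emeasure (D (snd p)) (E p))"
      by (simp add: prod.cartesian_product split_def)
    finally show "emeasure (distr (sampling_model d n D) ?G (uncurry_sites n d)) (Pi\<^sub>E ({..<n} \<times> {..<d}) E) =
        (\<Prod>p\<in>{..<n} \<times> {..<d}. emeasure (D (snd p)) (E p))" .
  qed auto
qed

text \<open>The right-hand side of the implication stands for equality of the lifted points: candidacy
  only excludes domination by points other than the lifted point itself.\<close>

definition order_candidates :: "nat \<Rightarrow> nat \<Rightarrow> (nat \<times> nat) set \<Rightarrow> (nat \<Rightarrow> nat \<Rightarrow> real) \<Rightarrow> nat set" where
  "order_candidates d n R \<beta> = {i \<in> {..<n}. \<forall>k\<in>{..<n}. (k, i) \<in> R \<and> (\<forall>j\<in>{..<d}. \<beta> k j \<le> \<beta> i j) \<longrightarrow>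
     (i, k) \<in> R \<and> (\<forall>j\<in>{..<d}. \<beta> k j = \<beta> i j)}"

definition distance_order :: "nat \<Rightarrow> (nat \<Rightarrow> real^2) \<Rightarrow> real^2 \<Rightarrow> (nat \<times> nat) set" where
  "distance_order n s x = {(i, k). i < n \<and> k < n \<and> norm (x - s i) \<le> norm (x - s k)}"

lemma lifted_point_eq_iff:
  assumes "\<beta> \<in> space (sampling_model d n D)" "i < n" "k < n"
  shows "lifted_point d s \<beta> x k = lifted_point d s \<beta> x i \<longleftrightarrow>
    norm (x - s k) = norm (x - s i) \<and> (\<forall>j<d. \<beta> k j = \<beta> i j)"
proof -
  \<comment> \<open>Samples are \<open>undefined\<close> off \<open>{..<d}\<close>, so agreement
    below d together with equal distances is equality of the lifted functions.\<close>
  have ext: "\<beta> l j = undefined" if "l < n" "\<not> j < d" for l j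
    using assms(1) that by (auto simp: sampling_model_def space_PiM PiE_iff extensional_def)
  show ?thesis
  proof
    assume eq: "lifted_point d s \<beta> x k = lifted_point d s \<beta> x i"
    have "\<beta> k j = \<beta> i j" if "j < d" for j
      using fun_cong[OF eq, of j] that by (simp add: lifted_point_def)
    then show "norm (x - s k) = norm (x - s i) \<and> (\<forall>j<d. \<beta> k j = \<beta> i j)"
      using fun_cong[OF eq, of d] by (simp add: lifted_point_def)
  next
    assume eq: "norm (x - s k) = norm (x - s i) \<and> (\<forall>j<d. \<beta> k j = \<beta> i j)"
    show "lifted_point d s \<beta> x k = lifted_point d s \<beta> x i"
    proof
      fix j
      show "lifted_point d s \<beta> x k j = lifted_point d s \<beta> x i j"
        using eq assms(2,3) ext[of k j] ext[of i j] by (cases "j < d") (auto simp: lifted_point_def)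
    qed
  qed
qed

lemma dominates_lifted_point_iff:
  "dominates (d + 1) (lifted_point d s \<beta> x k) (lifted_point d s \<beta> x i) \<longleftrightarrow>
    norm (x - s k) \<le> norm (x - s i) \<and> (\<forall>j<d. \<beta> k j \<le> \<beta> i j)"
  by (auto simp: dominates_def lifted_point_def less_Suc_eq)

lemma staircase_point_image_iff:
  assumes "i \<in> K"
  shows "staircase_point m (p ` K) (p i) \<longleftrightarrow> (\<forall>k\<in>K. dominates m (p k) (p i) \<longrightarrow> p k = p i)"
  using assms by (auto simp: staircase_point_def)

text \<open>Makes the dependence on \<open>x\<close> factor through \<open>distance_order\<close>,
  which takes finitely many values; the event over all \<open>x\<close> thereby becomes a finite
  intersection.\<close>

lemma candidate_set_eq:
  assumes "\<beta> \<in> space (sampling_model d n D)"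
  shows "candidate_set d n s \<beta> x = s ` order_candidates d n (distance_order n s x) \<beta>"
proof -
  have "staircase_point (d + 1) (lifted_points d n s \<beta> x) (lifted_point d s \<beta> x i) \<longleftrightarrow>
      i \<in> order_candidates d n (distance_order n s x) \<beta>" if i: "i < n" for i
  proof -
    have "staircase_point (d + 1) (lifted_points d n s \<beta> x) (lifted_point d s \<beta> x i) \<longleftrightarrow>
        (\<forall>k<n. norm (x - s k) \<le> norm (x - s i) \<and> (\<forall>j<d. \<beta> k j \<le> \<beta> i j) \<longrightarrow>
          lifted_point d s \<beta> x k = lifted_point d s \<beta> x i)"
      unfolding lifted_points_def staircase_point_image_iff[of i "{..<n}", unfolded lessThan_iff, OF i]
        dominates_lifted_point_iff Ball_def lessThan_iff
      by (simp only:)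
    also have "\<dots> \<longleftrightarrow> (\<forall>k<n. norm (x - s k) \<le> norm (x - s i) \<and> (\<forall>j<d. \<beta> k j \<le> \<beta> i j) \<longrightarrow>
        norm (x - s k) = norm (x - s i) \<and> (\<forall>j<d. \<beta> k j = \<beta> i j))"
      by (rule all_cong) (simp only: lifted_point_eq_iff[OF assms i])
    also have "\<dots> \<longleftrightarrow> (\<forall>k<n. norm (x - s k) \<le> norm (x - s i) \<and> (\<forall>j<d. \<beta> k j \<le> \<beta> i j) \<longrightarrow>
        norm (x - s i) \<le> norm (x - s k) \<and> (\<forall>j<d. \<beta> k j = \<beta> i j))"
    proof -
      \<comment> \<open>Given one inequality, equality of distances is the reverse inequality, which
        the relation can express.\<close>
      have antisym: "(norm (x - s k) = norm (x - s i)) = (norm (x - s i) \<le> norm (x - s k))"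
        if "norm (x - s k) \<le> norm (x - s i)" for k
        using that by linarith
      show ?thesis
        by (simp only: antisym cong: imp_cong conj_cong)
    qed
    also have "\<dots> \<longleftrightarrow> i \<in> order_candidates d n (distance_order n s x) \<beta>"
      unfolding order_candidates_def distance_order_def using i by (simp add: Ball_def)
    finally show ?thesis .
  qed
  moreover have "order_candidates d n (distance_order n s x) \<beta> \<subseteq> {..<n}"
    by (auto simp: order_candidates_def)
  ultimately show ?thesis
    unfolding candidate_set_def by blast
qed

text \<open>Distinct values exclude equal lifted points at different sites: they would already agree
  in coordinate 0, which exists since d \<ge> 1. So every other dominating site disqualifies a
  candidate.\<close>

lemma order_candidates_subset_undominated:
  assumes "distinct_values d n \<beta>" "d \<ge> 1"
  shows "order_candidates d n (distance_order n s x) \<beta> \<subseteq>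
    undominated d {..<n} (\<lambda>i. norm (x - s i)) (uncurry_sites n d \<beta>)"
proof
  fix i assume i: "i \<in> order_candidates d n (distance_order n s x) \<beta>"
  then have "i < n"
    by (simp add: order_candidates_def)
  have False if k: "k < n" "k \<noteq> i" "norm (x - s k) \<le> norm (x - s i)"
    and le: "coord_le d (uncurry_sites n d \<beta>) k i" for k
  proof -
    have "(k, i) \<in> distance_order n s x"
      using k \<open>i < n\<close> by (simp add: distance_order_def)
    moreover have "\<beta> k j \<le> \<beta> i j" if "j < d" for j
    proof -
      have "uncurry_sites n d \<beta> (k, j) \<le> uncurry_sites n d \<beta> (i, j)"
        using le that by (simp only: coord_le_def)
      then show ?thesis
        using that k(1) \<open>i < n\<close> by (simp add: uncurry_sites_def)
    qed
    moreover have "0 \<in> {..<d}" "k \<in> {..<n}"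
      using assms(2) k(1) by simp_all
    ultimately have "\<beta> k 0 = \<beta> i 0"
      using i unfolding order_candidates_def mem_Collect_eq by blast
    then have "(k, 0::nat) = (i, 0)"
      using k(1) \<open>i < n\<close> assms(2)
      by (intro inj_onD[OF assms(1)[unfolded distinct_values_def]]) simp_all
    then show False
      using k(2) by simp
  qed
  then show "i \<in> undominated d {..<n} (\<lambda>i. norm (x - s i)) (uncurry_sites n d \<beta>)"
    using \<open>i < n\<close> unfolding undominated_def by blast
qed

lemma sets_order_candidates_le:
  assumes "\<And>j. j < d \<Longrightarrow> sets (D j) = sets borel"
  shows "{\<beta> \<in> space (sampling_model d n D). real (card (order_candidates d n R \<beta>)) \<le> K} \<in>
    sets (sampling_model d n D)"
proof -
  let ?S = "sampling_model d n D"
  have comp: "(\<lambda>\<beta>. \<beta> i j) \<in> borel_measurable ?S" if "i < n" "j < d" for i j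
    using measurable_sampling_model_component[OF that, of D] assms[OF that(2)]
    by (simp cong: measurable_cong_sets)
  have le: "{\<beta> \<in> space ?S. \<forall>j\<in>{..<d}. \<beta> k j \<le> \<beta> i j} \<in> sets ?S"
    and eq: "{\<beta> \<in> space ?S. \<forall>j\<in>{..<d}. \<beta> k j = \<beta> i j} \<in> sets ?S" if "i < n" "k < n" for i k
    using that comp
    by (intro sets.sets_Collect_finite_All borel_measurable_le borel_measurable_eq comp; simp)+
  have *: "{\<beta> \<in> space ?S. \<forall>k\<in>{..<n}. (k, i) \<in> R \<and> (\<forall>j\<in>{..<d}. \<beta> k j \<le> \<beta> i j) \<longrightarrow>
      (i, k) \<in> R \<and> (\<forall>j\<in>{..<d}. \<beta> k j = \<beta> i j)} \<in> sets ?S" if "i < n" for i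
    using that
    by (intro sets.sets_Collect_finite_All sets.sets_Collect_imp sets.sets_Collect_conj
        sets.sets_Collect_const le eq) auto
  have mem: "{\<beta> \<in> space ?S. i \<in> order_candidates d n R \<beta>} \<in> sets ?S" for i
  proof (cases "i < n")
    case True
    from *[OF True] show ?thesis
      by (simp only: order_candidates_def mem_Collect_eq lessThan_iff True simp_thms)
  next
    case False
    then have "{\<beta> \<in> space ?S. i \<in> order_candidates d n R \<beta>} = {}"
      by (auto simp: order_candidates_def)
    then show ?thesis
      by (simp only: sets.empty_sets)
  qed
  have [measurable]: "(\<lambda>\<beta>. card (order_candidates d n R \<beta>)) \<in> measurable ?S (count_space UNIV)"
    by (rule measurable_card) (rule mem)
  show ?thesis
    by measurable
qed

lemma sq_plus_1_sq_le: "n \<ge> 2 \<Longrightarrow> (n\<^sup>2 + 1)\<^sup>2 \<le> n ^ 6" for n :: nat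
proof -
  assume n: "n \<ge> 2"
  then have "n\<^sup>2 + 1 \<le> 2 * n\<^sup>2"
    by (simp add: power2_eq_square)
  also have "\<dots> \<le> n ^ 3"
    using n by (simp add: power3_eq_cube power2_eq_square)
  finally have "(n\<^sup>2 + 1)\<^sup>2 \<le> (n ^ 3)\<^sup>2"
    by (rule power_mono) simp
  then show ?thesis
    by (simp flip: power_mult)
qed

section \<open>Union bound over the distance orders\<close>

theorem lemma6p6:
  fixes d :: nat and \<gamma> :: real
  assumes "d \<ge> 1" and "\<gamma> > 0"
  shows "\<exists>C::real. \<forall>n\<ge>2. \<forall>(s :: nat \<Rightarrow> real^2) (D :: nat \<Rightarrow> real measure).
    inj_on s {..<n} \<longrightarrow>
    (\<forall>j<d. atomless_unit_distribution (D j)) \<longrightarrow>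
    (AE \<beta> in sampling_model d n D. distinct_values d n \<beta>) \<longrightarrow>
    measure (sampling_model d n D)
      {\<beta> \<in> space (sampling_model d n D).
        \<forall>x. real (card (candidate_set d n s \<beta> x)) \<le> C * ln (real n) ^ d}
      \<ge> 1 - real n powr (- \<gamma>)"
proof -
  \<comment> \<open>The additional 6 in the exponent pays for the union over at most n^6
    orders.\<close>
  obtain C where C: "\<And>I D A n h. site_grid I D \<Longrightarrow> n \<ge> 2 \<Longrightarrow> A \<subseteq> I \<Longrightarrow> card A \<le> n \<Longrightarrow>
      emeasure (site_grid.grid I D d) {\<beta> \<in> space (site_grid.grid I D d).
        real (card (undominated d A h \<beta>)) > C * ln (real n) ^ d} \<le> ennreal (real n powr (- (\<gamma> + 6)))"
    using undominated_whp[of "\<gamma> + 6" d] assms(2) by (meson add_nonneg_nonneg less_imp_le zero_le_numeral)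
  show ?thesis
  proof (intro exI[of _ C] allI impI)
    fix n :: nat and s :: "nat \<Rightarrow> real^2" and D :: "nat \<Rightarrow> real measure"
    assume n: "n \<ge> 2" and s: "inj_on s {..<n}"
      and atomless: "\<forall>j<d. atomless_unit_distribution (D j)"
      and AE_distinct: "AE \<beta> in sampling_model d n D. distinct_values d n \<beta>"
    let ?S = "sampling_model d n D"
    let ?K = "C * ln (real n) ^ d"
    \<comment> \<open>\<open>D j\<close> is arbitrary for j \<ge> d, whereas the locale asks for a
      distribution at every index; a point mass at 0 fills the gap without changing the sampling
      model.\<close>
    define D' where "D' j = (if j < d then D j else return borel 0)" for j
    have D': "real_distribution (D' j)" for j
      using atomless
      by (auto simp: D'_def atomless_unit_distribution_def real_distribution_def
          real_distribution_axioms_def prob_space_return)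
    have S_eq: "?S = sampling_model d n D'"
      unfolding sampling_model_def by (intro PiM_cong) (simp_all add: D'_def)
    interpret site_grid "{..<n}" D'
      by (rule site_grid.intro) (simp, rule D')
    interpret prob_space ?S
      unfolding S_eq unfolding sampling_model_def by (intro prob_space_PiM prob_space_D)
    define Rs where "Rs = range (distance_order n s)"
    have Rs: "finite Rs" "card Rs \<le> n ^ 6"
      using card_distance_orders_le[of n s] sq_plus_1_sq_le[OF n]
      unfolding Rs_def distance_order_def by auto
    define Good where "Good R = {\<beta> \<in> space ?S. real (card (order_candidates d n R \<beta>)) \<le> ?K}" for R
    have Good: "Good R \<in> sets ?S" for R
      unfolding Good_def S_eq by (rule sets_order_candidates_le) simp
    have "card (candidate_set d n s \<beta> x) = card (order_candidates d n (distance_order n s x) \<beta>)"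
      if "\<beta> \<in> space ?S" for \<beta> x
    proof -
      have "order_candidates d n (distance_order n s x) \<beta> \<subseteq> {..<n}"
        by (auto simp: order_candidates_def)
      then show ?thesis
        unfolding candidate_set_eq[OF that] by (intro card_image inj_on_subset[OF s])
    qed
    \<comment> \<open>Injectivity of \<open>s\<close> turns counting sites into counting indices,
      and all \<open>x\<close> with the same order share one event. This also gives
      measurability.\<close>
    then have event: "{\<beta> \<in> space ?S. \<forall>x. real (card (candidate_set d n s \<beta> x)) \<le> ?K} =
        (\<Inter>R\<in>Rs. Good R)" (is "?E = _")
      by (auto simp: Rs_def Good_def)
    have bad: "measure ?S (space ?S - Good R) \<le> real n powr (- (\<gamma> + 6))" if R_mem: "R \<in> Rs" for R
    proof -
      obtain x where R: "R = distance_order n s x"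
        using R_mem by (auto simp: Rs_def)
      define h where "h = (\<lambda>i. norm (x - s i))"
      let ?U = "{\<beta> \<in> space (grid d). real (card (undominated d {..<n} h \<beta>)) > ?K}"
      have U: "?U \<in> sets (grid d)"
      proof -
        note [measurable] = measurable_card_undominated[of "{..<n}", OF subset_refl]
        show ?thesis
          by measurable
      qed
      have meas: "uncurry_sites n d \<in> measurable ?S (grid d)"
        unfolding S_eq by (rule measurable_uncurry_sites)
      \<comment> \<open>Values are distinct only almost surely, so the inclusion of events holds up
        to a null set.\<close>
      have "emeasure ?S (space ?S - Good R) \<le> emeasure ?S (uncurry_sites n d -` ?U \<inter> space ?S)"
      proof (rule emeasure_mono_AE)
        show "AE \<beta> in ?S. \<beta> \<in> space ?S - Good R \<longrightarrow> \<beta> \<in> uncurry_sites n d -` ?U \<inter> space ?S"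
          using AE_distinct
        proof eventually_elim
          case (elim \<beta>)
          have "card (order_candidates d n R \<beta>) \<le> card (undominated d {..<n} h (uncurry_sites n d \<beta>))"
            unfolding R h_def
            by (intro card_mono order_candidates_subset_undominated[OF elim assms(1)]
                finite_subset[OF undominated_subset]) simp
          then show ?case
            using measurable_space[OF meas] by (auto simp: Good_def)
        qed
        show "uncurry_sites n d -` ?U \<inter> space ?S \<in> sets ?S"
          by (rule measurable_sets[OF meas U])
      qed
      also have "\<dots> = emeasure (distr ?S (grid d) (uncurry_sites n d)) ?U"
        by (rule emeasure_distr[OF meas U, symmetric])
      also have "\<dots> = emeasure (grid d) ?U"
        unfolding S_eq
        by (rule arg_cong[where f = "\<lambda>M. emeasure M ?U"])
          (rule distr_sampling_model_uncurry_sites[OF prob_space_D])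
      also have "\<dots> \<le> ennreal (real n powr (- (\<gamma> + 6)))"
        by (rule C) (use n site_grid_axioms in auto)
      finally show ?thesis
        by (simp add: emeasure_eq_measure)
    qed
    have "?E \<in> sets ?S"
      unfolding event using Rs Good by (intro sets.finite_INT) (auto simp: Rs_def)
    then have "1 - measure ?S ?E = measure ?S (space ?S - ?E)"
      by (simp add: prob_compl)
    also have "space ?S - ?E = (\<Union>R\<in>Rs. space ?S - Good R)"
      unfolding event by (auto simp: Rs_def)
    also have "measure ?S \<dots> \<le> (\<Sum>R\<in>Rs. measure ?S (space ?S - Good R))"
      using Rs Good by (intro finite_measure_subadditive_finite) auto
    also have "\<dots> \<le> (\<Sum>R\<in>Rs. real n powr (- (\<gamma> + 6)))"
      by (intro sum_mono bad)
    also have "\<dots> \<le> real n ^ 6 * real n powr (- (\<gamma> + 6))"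
    proof -
      have "real (card Rs) \<le> real n ^ 6"
        using Rs(2) by (metis of_nat_mono of_nat_power)
      then show ?thesis
        by (simp only: sum_constant) (rule mult_right_mono, simp_all)
    qed
    also have "\<dots> = real n powr 6 * real n powr (- (\<gamma> + 6))"
      using n by simp
    also have "\<dots> = real n powr (6 + - (\<gamma> + 6))"
      by (rule powr_add[symmetric])
    also have "6 + - (\<gamma> + 6) = - \<gamma>"
      by simp
    finally show "measure ?S ?E \<ge> 1 - real n powr (- \<gamma>)"
      by simp
  qed
qed

end
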